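(* The following constraints are valid inequalities for the formulation (SL-MCFLP), i.e. every feasible solution $(x,y,u)$ of (SL-MCFLP) satisfies $$\sum_{s\in S_1} y_{is}\le \sum_{j\in \bigcup_{s\in S_1}J(i,s)} x_{jm}\qquad\text{for all } i\in I,\ m\in M_I(i),\ S_1\subseteq S_I(i)\cap S_M(m).$$
   Context: Data. $I$ (clients), $J$ (potential second-level facilities), $M$ (products), $S$ (first-level facilities) are finite sets. Each $s\in S$ offers one product $m(s)\in M$. $M_I(i)\subseteq M$ is the set of products demanded by client $i$. $d_{sj}$ and $d_{ji}$ are distances between $s\in S$ and $j\in J$, and between $j\in J$ and $i\in I$; $R_m, r_m$ are covering radii for each $m\in M$. For $j\in J$, $b_j$ is a nonnegative integer (maximum number of different products $j$ can offer), and $T(j)=\{0,1,\dots,b_j\}$. $w_{is}$ is the (real) satisfaction of client $i$ when served product $m(s)$ from $s$; $c_{jt}$ is the cost of offering $t\in T(j)$ different products at $j$ (nondecreasing in $t$); $B$ is the budget. Derived sets. - $J(i,s)=\{j\in J: d_{ji}\le r_{m(s)},\ d_{sj}\le R_{m(s)}\}$. - $S_M(m)=\{s\in S: m(s)=m\}$. - $M_J(j)=\{m\in M:\exists s\in S \text{ with } m(s)=m,\ d_{sj}\le R_m\}$. - $S_I(i)=\{s\in S: m(s)\in M_I(i),\ J(i,s)\ne\emptyset\}$. Formulation (SL-MCFLP). Variables $y_{is}$ ($i\in I, s\in S_I(i)$), $x_{jm}$ ($j\in J, m\in M_J(j)$), $u_{jt}$ ($j\in J,t\in T(j)$): $$\max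 \sum_{i\in I}\sum_{s\in S_I(i)} w_{is}y_{is}$$ subject to - $\sum_{j\in J(i,s)}x_{jm(s)}\ge y_{is}$ for $i\in I, s\in S_I(i)$; - $\sum_{s\in S_I(i)\cap S_M(m)}y_{is}\le 1$ for $i\in I, m\in M_I(i)$; - $\sum_{m\in M_J(j)}x_{jm}=\sum_{t\in T(j)}t\,u_{jt}$ for $j\in J$; - $\sum_{t\in T(j)}u_{jt}=1$ for $j\in J$; - $\sum_{j\in J}\sum_{t\in T(j)}c_{jt}u_{jt}\le B$; - $y_{is}\in\{0,1\}$, $x_{jm}\in\{0,1\}$, $u_{jt}\in\{0,1\}$ for all indices. *)

theory Defs
  imports Complex_Main
begin

text \<open>
  Data of an instance. The two kinds of distance, d_sj and d_ji, are separate fields;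
  \<open>max_offer j\<close> is b_j, and \<open>cover1\<close>, \<open>cover2\<close> are the radii R_m (first level to second level)
  and r_m (second level to client).
\<close>

record ('i, 'j, 'm, 's) instance_data =
  clients :: "'i set"
  facs :: "'j set"
  products :: "'m set"
  sources :: "'s set"
  product_of :: "'s \<Rightarrow> 'm"
  demands :: "'i \<Rightarrow> 'm set"
  dist1 :: "'s \<Rightarrow> 'j \<Rightarrow> real"
  dist2 :: "'j \<Rightarrow> 'i \<Rightarrow> real"
  cover1 :: "'m \<Rightarrow> real"
  cover2 :: "'m \<Rightarrow> real"
  max_offer :: "'j \<Rightarrow> nat"
  satisfaction :: "'i \<Rightarrow> 's \<Rightarrow> real"
  offer_cost :: "'j \<Rightarrow> nat \<Rightarrow> real"
  budget :: real

definition T_set :: "('i, 'j, 'm, 's) instance_data \<Rightarrow> 'j \<Rightarrow> nat set" where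
  "T_set P j = {0..max_offer P j}"

definition valid_instance :: "('i, 'j, 'm, 's) instance_data \<Rightarrow> bool" where
  "valid_instance P \<longleftrightarrow>
     finite (clients P) \<and> finite (facs P) \<and> finite (products P) \<and> finite (sources P) \<and>
     (\<forall>s\<in>sources P. product_of P s \<in> products P) \<and>
     (\<forall>i\<in>clients P. demands P i \<subseteq> products P) \<and>
     (\<forall>s\<in>sources P. \<forall>j\<in>facs P. dist1 P s j \<ge> 0) \<and>
     (\<forall>j\<in>facs P. \<forall>i\<in>clients P. dist2 P j i \<ge> 0) \<and>
     (\<forall>j\<in>facs P. mono_on (T_set P j) (offer_cost P j))"

definition J_set :: "('i, 'j, 'm, 's) instance_data \<Rightarrow> 'i \<Rightarrow> 's \<Rightarrow> 'j set" where
  "J_set P i s = {j \<in> facs P. dist2 P j i \<le> cover2 P (product_of P s) \<and>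
                              dist1 P s j \<le> cover1 P (product_of P s)}"

definition S_M :: "('i, 'j, 'm, 's) instance_data \<Rightarrow> 'm \<Rightarrow> 's set" where
  "S_M P m = {s \<in> sources P. product_of P s = m}"

definition M_J :: "('i, 'j, 'm, 's) instance_data \<Rightarrow> 'j \<Rightarrow> 'm set" where
  "M_J P j = {m \<in> products P. \<exists>s\<in>sources P. product_of P s = m \<and> dist1 P s j \<le> cover1 P m}"

definition S_I :: "('i, 'j, 'm, 's) instance_data \<Rightarrow> 'i \<Rightarrow> 's set" where
  "S_I P i = {s \<in> sources P. product_of P s \<in> demands P i \<and> J_set P i s \<noteq> {}}"

text \<open>
  Variables are total functions. Only the values at the indices of the formulation
  (y i s for s in S_I(i), x j m for m in M_J(j), u j t for t in T(j)) are constrained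
  or occur in a constraint.
\<close>

definition objective ::
  "('i, 'j, 'm, 's) instance_data \<Rightarrow> ('i \<Rightarrow> 's \<Rightarrow> real) \<Rightarrow> real" where
  "objective P y = (\<Sum>i\<in>clients P. \<Sum>s\<in>S_I P i. satisfaction P i s * y i s)"

definition feasible ::
  "('i, 'j, 'm, 's) instance_data \<Rightarrow> ('j \<Rightarrow> 'm \<Rightarrow> real) \<Rightarrow> ('i \<Rightarrow> 's \<Rightarrow> real) \<Rightarrow>
   ('j \<Rightarrow> nat \<Rightarrow> real) \<Rightarrow> bool" where
  "feasible P x y u \<longleftrightarrow>
     (\<forall>i\<in>clients P. \<forall>s\<in>S_I P i. (\<Sum>j\<in>J_set P i s. x j (product_of P s)) \<ge> y i s) \<and>
     (\<forall>i\<in>clients P. \<forall>m\<in>demands P i. (\<Sum>s\<in>S_I P i \<inter> S_M P m. y i s) \<le> 1) \<and>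
     (\<forall>j\<in>facs P. (\<Sum>m\<in>M_J P j. x j m) = (\<Sum>t\<in>T_set P j. real t * u j t)) \<and>
     (\<forall>j\<in>facs P. (\<Sum>t\<in>T_set P j. u j t) = 1) \<and>
     (\<Sum>j\<in>facs P. \<Sum>t\<in>T_set P j. offer_cost P j t * u j t) \<le> budget P \<and>
     (\<forall>i\<in>clients P. \<forall>s\<in>S_I P i. y i s \<in> {0, 1}) \<and>
     (\<forall>j\<in>facs P. \<forall>m\<in>M_J P j. x j m \<in> {0, 1}) \<and>
     (\<forall>j\<in>facs P. \<forall>t\<in>T_set P j. u j t \<in> {0, 1})"

end

theory Submission
  imports Defs
begin

text \<open>
  By the assignment constraint the left-hand side is at most 1. If it is positive, some
  \<open>s \<in> S1\<close> has \<open>y i s = 1\<close>, and the covering constraint of this single \<open>s\<close> already makes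
  the right-hand side at least 1.
\<close>

text \<open>The source \<open>s\<close> itself is the witness required by \<open>M_J\<close>, since
  \<open>J_set\<close> includes the first-level radius condition. This matters because
  \<open>feasible\<close> makes \<open>x j m\<close> binary only for
  \<open>m \<in> M_J P j\<close>.\<close>

lemma J_set_imp_M_J:
  assumes "valid_instance P" "s \<in> sources P" "j \<in> J_set P i s"
  shows "product_of P s \<in> M_J P j"
  using assms by (auto simp: valid_instance_def J_set_def M_J_def)

theorem proposition3p2:
  fixes P :: "('i, 'j, 'm, 's) instance_data"
    and x :: "'j \<Rightarrow> 'm \<Rightarrow> real"
    and y :: "'i \<Rightarrow> 's \<Rightarrow> real"
    and u :: "'j \<Rightarrow> nat \<Rightarrow> real"
  assumes "valid_instance P"
    and "feasible P x y u"
  shows "\<forall>i\<in>clients P. \<forall>m\<in>demands P i. \<forall>S1. S1 \<subseteq> S_I P i \<inter> S_M P m \<longrightarrow>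
           (\<Sum>s\<in>S1. y i s) \<le> (\<Sum>j\<in>(\<Union>s\<in>S1. J_set P i s). x j m)"
proof (intro ballI allI impI)
  fix i m S1
  assume i: "i \<in> clients P" and m: "m \<in> demands P i" and S1: "S1 \<subseteq> S_I P i \<inter> S_M P m"
  let ?J = "\<Union>s\<in>S1. J_set P i s"
  have fin: "finite (S_I P i \<inter> S_M P m)" "finite ?J"
    using assms(1) by (auto simp: valid_instance_def S_I_def J_set_def intro: finite_subset[of _ "facs P"])
  have y01: "y i s = 0 \<or> y i s = 1" if "s \<in> S_I P i" for s
    using assms(2) i that by (auto simp: feasible_def)
  \<comment> \<open>Every facility in the union is covered by some source of product
    \<open>m\<close>, so \<open>x j m\<close> is a genuine variable of the formulation and not an
    unconstrained value of the total function.\<close>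
  have x_nonneg: "x j m \<ge> 0" if "j \<in> ?J" for j
  proof -
    from that obtain s where s: "s \<in> S1" "j \<in> J_set P i s" by blast
    with S1 have "s \<in> sources P" "product_of P s = m" by (auto simp: S_M_def)
    with J_set_imp_M_J[OF assms(1) _ s(2)] have "m \<in> M_J P j" by auto
    moreover have "j \<in> facs P" using s(2) by (simp add: J_set_def)
    ultimately have "x j m \<in> {0, 1}" using assms(2) unfolding feasible_def by blast
    then show ?thesis by auto
  qed
  show "(\<Sum>s\<in>S1. y i s) \<le> (\<Sum>j\<in>?J. x j m)"
  proof (cases "\<exists>s\<in>S1. y i s = 1")
    case True
    then obtain s where s: "s \<in> S1" "y i s = 1" by blast
    then have "s \<in> S_I P i" "product_of P s = m" using S1 by (auto simp: S_M_def)
    \<comment> \<open>Adding nonnegative terms extends the sum to the full range of the assignment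
      constraint.\<close>
    have "(\<Sum>s\<in>S1. y i s) \<le> (\<Sum>s\<in>S_I P i \<inter> S_M P m. y i s)"
      using fin(1) S1 y01 by (intro sum_mono2) force+
    \<comment> \<open>The bound 1 is written as \<open>y i s\<close>, the quantity bounded by the
      covering constraint of \<open>s\<close>.\<close>
    also have "\<dots> \<le> y i s"
      using assms(2) i m s(2) by (simp add: feasible_def)
    also have "\<dots> \<le> (\<Sum>j\<in>J_set P i s. x j m)"
      using assms(2) i \<open>s \<in> S_I P i\<close> \<open>product_of P s = m\<close> by (auto simp: feasible_def)
    \<comment> \<open>Facilities that cover \<open>i\<close> only through other sources in
      \<open>S1\<close> add nonnegative terms.\<close>
    also have "\<dots> \<le> (\<Sum>j\<in>?J. x j m)"
      using fin(2) s(1) x_nonneg by (intro sum_mono2) auto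
    finally show ?thesis .
  next
    case False
    then have "(\<Sum>s\<in>S1. y i s) = 0"
      using y01 S1 by (intro sum.neutral) blast
    also have "\<dots> \<le> (\<Sum>j\<in>?J. x j m)"
      using x_nonneg by (rule sum_nonneg)
    finally show ?thesis .
  qed
qed

end
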